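(* Let $X$ be a non-empty set, $S$ a positive ordered commutative semigroup with zero, and $f$ a function from $X$ to $S$ with the property that for all $w,z\in X$, if $f(w)f(z)\neq 0$, then there exists a $v\in X$ such that $f(w)f(z)\leq f(v)$, $f(v)\leq f(w)$, and $f(v)\leq f(z)$. If the graph $\Gamma_{(S,f)}(X)$ is non-empty, then it is connected and $\operatorname{diam}(\Gamma_{(S,f)}(X))\leq 3$.
   Context: A commutative semigroup with zero $(S,\cdot,0)$ is a commutative multiplicative semigroup with an element $0$ satisfying $0\cdot s=0$ for all $s\in S$. A commutative semigroup $(S,\cdot)$ is called positive ordered if it has a zero $0$ and there is a partial order $\leq$ on $S$ such that: (1) $x\leq y$ implies $xz\leq yz$ for all $x,y,z\in S$; (2) $0<x$ and $0<y$ imply $0<xy$ for all $x,y\in S$. Given a non-empty set $X$ and a function $f:X\to S$, the simple graph $\Gamma_{(S,f)}(X)$ is defined as follows. An element $x\in X$ is a vertex if $f(x)\neq 0$ and there is a $y\in X$ with $y\neq x$, $f(y)\neq 0$ and $f(x)\cdot f(y)=0$. For $x,y\in X$, $\{x,y\}$ is an edge if $x\neq y$, $f(x)\neq 0$, $f(y)\neq 0$ and $f(x)\cdot f(y)=0$. The graph is non-empty if it has at least one vertex. The distance between two vertices is the number of edges in a shortest path connecting them, and the diameter $\operatorname{diam}$ is the greatest distance between any two vertices. *)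

theory Defs
  imports "Graph_Theory.Graph_Theory" "HOL-Library.Extended_Nat"
begin

text \<open>
  The order is only compatible with multiplication. It is not required that \<open>0 \<le> x\<close>: if \<open>0\<close> were
  the least element, the last axiom would exclude zero divisors.
\<close>

class positive_ordered_comm_semigroup = ab_semigroup_mult + mult_zero + order +
  assumes mult_right_mono_le: "x \<le> y \<Longrightarrow> x * z \<le> y * z"
    and mult_pos_pos_zero: "0 < x \<Longrightarrow> 0 < y \<Longrightarrow> 0 < x * y"

text \<open>
  A simple graph is represented as a symmetric loop-free digraph without parallel arcs: the
  undirected edge \<open>{x, y}\<close> is the pair of arcs \<open>(x, y)\<close> and \<open>(y, x)\<close>.
\<close>

definition zero_prod_graph :: "'x set \<Rightarrow> ('x \<Rightarrow> 's::positive_ordered_comm_semigroup) \<Rightarrow> 'x pair_pre_digraph" where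
  "zero_prod_graph X f =
    \<lparr> pverts = {x \<in> X. f x \<noteq> 0 \<and> (\<exists>y\<in>X. y \<noteq> x \<and> f y \<noteq> 0 \<and> f x * f y = 0)},
      parcs = {(x, y). x \<in> X \<and> y \<in> X \<and> x \<noteq> y \<and> f x \<noteq> 0 \<and> f y \<noteq> 0 \<and> f x * f y = 0} \<rparr>"

lemma pair_bidirected_digraph_zero_prod_graph: "pair_bidirected_digraph (zero_prod_graph X f)"
proof
  fix e assume "e \<in> parcs (zero_prod_graph X f)"
  then obtain x y where e: "e = (x, y)" and
    xy: "x \<in> X" "y \<in> X" "x \<noteq> y" "f x \<noteq> 0" "f y \<noteq> 0" "f x * f y = 0"
    by (auto simp: zero_prod_graph_def)
  have yx: "f y * f x = 0"
    using xy by (simp add: mult.commute)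
  show "fst e \<in> pverts (zero_prod_graph X f)"
    unfolding zero_prod_graph_def using e xy by force
  show "snd e \<in> pverts (zero_prod_graph X f)"
    unfolding zero_prod_graph_def using e xy yx by force
  show "fst e \<noteq> snd e"
    using e xy by simp
next
  show "symmetric (with_proj (zero_prod_graph X f))"
    by (auto simp: zero_prod_graph_def symmetric_def arcs_ends_conv mult.commute intro!: symI)
qed

text \<open>
  The infimum of the empty set is \<open>\<infinity>\<close>, so vertices that no path connects are at infinite distance.
\<close>

definition graph_dist :: "('a, 'b) pre_digraph \<Rightarrow> 'a \<Rightarrow> 'a \<Rightarrow> enat" where
  "graph_dist G u v = (INF p \<in> {p. pre_digraph.apath G u p v}. enat (length p))"

definition graph_diam :: "('a, 'b) pre_digraph \<Rightarrow> enat" where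
  "graph_diam G = (SUP u \<in> verts G. SUP v \<in> verts G. graph_dist G u v)"

end

theory Submission
  imports Defs
begin

text \<open>
  Let \<open>x\<close> and \<open>y\<close> be distinct, non-adjacent vertices, and choose a neighbour \<open>a\<close> of \<open>x\<close> and a
  neighbour \<open>b\<close> of \<open>y\<close>. If \<open>a = b\<close> or \<open>f a * f b = 0\<close>, then \<open>x\<close> and \<open>y\<close> are joined through \<open>a\<close> and
  \<open>b\<close>. Otherwise the hypothesis on \<open>f\<close> yields \<open>v\<close> with \<open>f a * f b \<le> f v\<close>, \<open>f v \<le> f a\<close> and
  \<open>f v \<le> f b\<close>. Multiplying these bounds by \<open>f x\<close> squeezes \<open>f x * f v\<close> between two zeros, since
  \<open>f x * f a = 0\<close>; in the same way \<open>f y * f v = 0\<close>. Finally \<open>f v \<noteq> 0\<close>: otherwise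
  \<open>f a * f b \<le> 0\<close>, while \<open>f a\<close> and \<open>f b\<close>, being nonzero and at least \<open>f v = 0\<close>, have a positive
  product. So \<open>v\<close> is a common neighbour of \<open>x\<close> and \<open>y\<close>.

  Every pair of vertices is thus joined by a walk of length at most three. Deleting the cycles of a
  walk gives a path that is no longer, so the walk bounds the distance; connectedness is immediate.
\<close>

lemma mult_left_mono_le:
  fixes x y z :: "'s::positive_ordered_comm_semigroup"
  shows "x \<le> y \<Longrightarrow> z * x \<le> z * y"
  by (simp add: mult.commute mult_right_mono_le)

text \<open>
  Both ends of the order interval from \<open>a * b\<close> to \<open>a\<close> are multiples of \<open>a\<close> (or \<open>a\<close> itself), so
  multiplication by \<open>c\<close> sends both to \<open>0\<close> and, being monotone, also everything between them.
\<close>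

lemma mult_eq_zero_between:
  fixes a b c t :: "'s::positive_ordered_comm_semigroup"
  assumes "c * a = 0" "a * b \<le> t" "t \<le> a"
  shows "c * t = 0"
proof (rule order.antisym)
  show "c * t \<le> 0"
    using mult_left_mono_le[OF assms(3), of c] assms(1) by simp
  have "c * (a * b) = 0"
    using assms(1) by (simp flip: mult.assoc)
  then show "0 \<le> c * t"
    using mult_left_mono_le[OF assms(2), of c] by simp
qed

text \<open>
  If the common lower bound \<open>t\<close> of \<open>a\<close> and \<open>b\<close> were \<open>0\<close>, then both would be positive,
  and hence so would their product, which lies below \<open>t\<close>.
\<close>

lemma nonzero_between_mult_and_factors:
  fixes a b t :: "'s::positive_ordered_comm_semigroup"
  assumes "a \<noteq> 0" "b \<noteq> 0" "a * b \<le> t" "t \<le> a" "t \<le> b"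
  shows "t \<noteq> 0"
proof
  assume "t = 0"
  with assms have "0 < a" "0 < b" "a * b \<le> 0"
    by auto
  then show False
    using mult_pos_pos_zero[of a b] by auto
qed

lemma (in wf_digraph) length_awalk_to_apath_le:
  assumes "awalk u p v"
  shows "length (awalk_to_apath p) \<le> length p"
  using assms
proof (induct rule: awalk_to_apath_induct)
  case (path p)
  then have "awalk_to_apath p = p"
    by (auto simp: awalk_to_apath.simps)
  then show ?case by simp
next
  case (decomp p q r s)
  then show ?case
    using step_awalk_to_apath[OF decomp(1-3)] by (auto elim!: awalk_cyc_decompE)
qed

lemma (in wf_digraph) graph_dist_le_length_awalk:
  assumes "awalk u p v"
  shows "graph_dist G u v \<le> enat (length p)"
proof -
  have "graph_dist G u v \<le> enat (length (awalk_to_apath p))"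
    unfolding graph_dist_def using apath_awalk_to_apath[OF assms] by (auto intro: INF_lower)
  also have "\<dots> \<le> enat (length p)"
    using length_awalk_to_apath_le[OF assms] by simp
  finally show ?thesis .
qed

lemma arc_zero_prod_graph_iff:
  "(x, y) \<in> parcs (zero_prod_graph X f) \<longleftrightarrow>
     x \<in> X \<and> y \<in> X \<and> x \<noteq> y \<and> f x \<noteq> 0 \<and> f y \<noteq> 0 \<and> f x * f y = 0"
  by (simp add: zero_prod_graph_def)

lemma arc_zero_prod_graph_sym:
  "(x, y) \<in> parcs (zero_prod_graph X f) \<Longrightarrow> (y, x) \<in> parcs (zero_prod_graph X f)"
  by (auto simp: arc_zero_prod_graph_iff mult.commute)

lemma vert_zero_prod_graph_neighbour:
  assumes "x \<in> pverts (zero_prod_graph X f)"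
  obtains a where "(x, a) \<in> parcs (zero_prod_graph X f)"
  using assms by (auto simp: zero_prod_graph_def)

text \<open>
  The hypothesis on \<open>f\<close> is applied to the neighbours \<open>a\<close> and \<open>b\<close>, not to \<open>x\<close> and \<open>y\<close>: whatever
  lies between \<open>f a * f b\<close> and both factors is annihilated by \<open>f x\<close> through \<open>f a\<close> and by \<open>f y\<close>
  through \<open>f b\<close>.
\<close>

lemma common_neighbour_if_neighbours_not_adjacent:
  assumes between: "\<And>w z. w \<in> X \<Longrightarrow> z \<in> X \<Longrightarrow> f w * f z \<noteq> 0 \<Longrightarrow>
      \<exists>v\<in>X. f w * f z \<le> f v \<and> f v \<le> f w \<and> f v \<le> f z"
    and xa: "(x, a) \<in> parcs (zero_prod_graph X f)"
    and yb: "(y, b) \<in> parcs (zero_prod_graph X f)"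
    and ab: "f a * f b \<noteq> 0" and xy: "f x * f y \<noteq> 0"
  obtains v where "(x, v) \<in> parcs (zero_prod_graph X f)" "(v, y) \<in> parcs (zero_prod_graph X f)"
proof -
  have X: "x \<in> X" "y \<in> X" "a \<in> X" "b \<in> X"
    and nz: "f x \<noteq> 0" "f y \<noteq> 0" "f a \<noteq> 0" "f b \<noteq> 0"
    and zero: "f x * f a = 0" "f y * f b = 0"
    using xa yb by (auto simp: arc_zero_prod_graph_iff)
  obtain v where v: "v \<in> X" "f a * f b \<le> f v" "f v \<le> f a" "f v \<le> f b"
    using between[OF X(3,4) ab] by blast
  have xv: "f x * f v = 0"
    by (rule mult_eq_zero_between[OF zero(1) v(2,3)])
  have yv: "f y * f v = 0"
    using mult_eq_zero_between[OF zero(2), of "f a"] v by (simp add: mult.commute)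
  have "f v \<noteq> 0"
    by (rule nonzero_between_mult_and_factors[OF nz(3,4) v(2-4)])
  \<comment> \<open>If \<open>v\<close> were \<open>x\<close> or \<open>y\<close>, one of the vanishing products \<open>f x * f v\<close> and \<open>f y * f v\<close>
      would be \<open>f x * f y\<close>.\<close>
  moreover have "v \<noteq> x" "v \<noteq> y"
    using xv yv xy by (auto simp: mult.commute)
  ultimately show thesis
    using X nz v(1) xv yv by (intro that[of v]) (auto simp: arc_zero_prod_graph_iff mult.commute)
qed

lemma short_awalk_zero_prod_graph:
  assumes between: "\<And>w z. w \<in> X \<Longrightarrow> z \<in> X \<Longrightarrow> f w * f z \<noteq> 0 \<Longrightarrow>
      \<exists>v\<in>X. f w * f z \<le> f v \<and> f v \<le> f w \<and> f v \<le> f z"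
    and x: "x \<in> pverts (zero_prod_graph X f)" and y: "y \<in> pverts (zero_prod_graph X f)"
  obtains p where "pre_digraph.awalk (with_proj (zero_prod_graph X f)) x p y" "length p \<le> 3"
proof -
  interpret pair_bidirected_digraph "zero_prod_graph X f"
    by (rule pair_bidirected_digraph_zero_prod_graph)
  note walk = awalk_Cons_iff awalk_Nil_iff
  obtain a where xa: "(x, a) \<in> parcs (zero_prod_graph X f)"
    using x by (rule vert_zero_prod_graph_neighbour)
  obtain b where yb: "(y, b) \<in> parcs (zero_prod_graph X f)"
    using y by (rule vert_zero_prod_graph_neighbour)
  note b_y = arc_zero_prod_graph_sym[OF yb]
  \<comment> \<open>The cases overlap, and the walks may repeat vertices, for instance in the fourth when \<open>b = x\<close>.\<close>
  consider "x = y" | "(x, y) \<in> parcs (zero_prod_graph X f)" | "a = b"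
    | "(a, b) \<in> parcs (zero_prod_graph X f)" | "f a * f b \<noteq> 0" "f x * f y \<noteq> 0"
    using xa yb by (auto simp: arc_zero_prod_graph_iff)
  then show thesis
  proof cases
    case 1
    then show thesis
      using y by (intro that[of "[]"]) (auto simp: walk)
  next
    case 2
    then show thesis
      using y by (intro that[of "[(x, y)]"]) (auto simp: walk)
  next
    case 3
    then show thesis
      using xa b_y y by (intro that[of "[(x, a), (a, y)]"]) (auto simp: walk)
  next
    case 4
    then show thesis
      using xa b_y y by (intro that[of "[(x, a), (a, b), (b, y)]"]) (auto simp: walk)
  next
    case 5
    obtain v where "(x, v) \<in> parcs (zero_prod_graph X f)" "(v, y) \<in> parcs (zero_prod_graph X f)"
      using common_neighbour_if_neighbours_not_adjacent[OF between xa yb 5] by blast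
    then show thesis
      using y by (intro that[of "[(x, v), (v, y)]"]) (auto simp: walk)
  qed
qed

theorem theorem3p10:
  fixes X :: "'x set"
    and f :: "'x \<Rightarrow> 's::positive_ordered_comm_semigroup"
  assumes "X \<noteq> {}"
    and "\<And>w z. w \<in> X \<Longrightarrow> z \<in> X \<Longrightarrow> f w * f z \<noteq> 0 \<Longrightarrow>
           \<exists>v\<in>X. f w * f z \<le> f v \<and> f v \<le> f w \<and> f v \<le> f z"
    and "pverts (zero_prod_graph X f) \<noteq> {}"
  shows "connected (with_proj (zero_prod_graph X f)) \<and>
         graph_diam (with_proj (zero_prod_graph X f)) \<le> 3"
proof
  interpret pair_bidirected_digraph "zero_prod_graph X f"
    by (rule pair_bidirected_digraph_zero_prod_graph)
  let ?G = "with_proj (zero_prod_graph X f)"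
  have short: "\<exists>p. awalk x p y \<and> length p \<le> 3" if "x \<in> verts ?G" "y \<in> verts ?G" for x y
    using short_awalk_zero_prod_graph[OF assms(2), of x y] that by auto
  have "x \<rightarrow>\<^sup>*\<^bsub>mk_symmetric ?G\<^esub> y" if "x \<in> verts ?G" "y \<in> verts ?G" for x y
  proof (rule reachable_mk_symmetricI)
    show "x \<rightarrow>\<^sup>*\<^bsub>?G\<^esub> y"
      using short[OF that] by (auto simp: reachable_awalk)
  qed
  then show "connected ?G"
    unfolding connected_def strongly_connected_def using assms(3) by simp
  have "graph_dist ?G x y \<le> 3" if xy: "x \<in> verts ?G" "y \<in> verts ?G" for x y
  proof -
    obtain p where p: "awalk x p y" "length p \<le> 3"
      using short[OF xy] by blast
    have "graph_dist ?G x y \<le> enat (length p)"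
      by (rule graph_dist_le_length_awalk[OF p(1)])
    also have "\<dots> \<le> 3"
      using p(2) by (simp add: numeral_eq_enat)
    finally show ?thesis .
  qed
  then show "graph_diam ?G \<le> 3"
    unfolding graph_diam_def by (intro SUP_least)
qed

end
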